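(* Let $X$ be a metric space with unbounded metric. If the Hilbert space compression $R(X)$ is nonzero, then $X$ is uniformly embeddable in a Hilbert space.
   Context: A function $f:X\to Y$ between metric spaces is large-scale Lipschitz if there are $C>0$, $D\ge 0$ with $d_Y(f(x),f(x'))\le C\,d_X(x,x')+D$ for all $x,x'\in X$. Let $X$ be a metric space with unbounded metric. The compression of a large-scale Lipschitz map $f:X\to Y$ is $\rho_f(r)=\inf_{d_X(x,y)\ge r} d_Y(f(x),f(y))$. With $\rho_f^*(r)=\max\{\rho_f(r),1\}$, the asymptotic compression of $f$ is $R_f=\liminf_{r\to\infty}\frac{\log\rho_f^*(r)}{\log r}$. The Hilbert space compression $R(X)$ is the supremum of $R_f$ over all large-scale Lipschitz maps $f:X\to\mathcal H$ into Hilbert spaces $\mathcal H$. A uniform embedding of $X$ into $Y$ is a function $f:X\to Y$ for which there exist non-decreasing functions $\rho_\pm:[0,\infty)\to\mathbb R$ with $\lim_{r\to\infty}\rho_\pm(r)=+\infty$ and $\rho_-(d_X(x,y))\le d_Y(f(x),f(y))\le\rho_+(d_X(x,y))$ for all $x,y\in X$. $X$ is uniformly embeddable in a Hilbert space if there is a uniform embedding of $X$ into some Hilbert space. *)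

theory Defs
  imports "HOL-Analysis.Analysis" "HOL-Algebra.Module"
begin

text \<open>
  Ranging over all Hilbert spaces inside a formula requires Hilbert spaces as objects rather than
  as a type class. They are rendered as real vector spaces on carrier sets, in the style of
  HOL-Algebra, with an inner product. Complex Hilbert spaces are included by restriction of scalars
  (inner product \<open>Re\<close> of the complex one), which does not change the metric.
  The fields \<open>mult\<close> and \<open>one\<close> that a module record inherits from rings play no role.
\<close>

definition real_ring :: "real ring" where
  "real_ring = \<lparr>carrier = UNIV, mult = (*), one = 1, zero = 0, add = (+)\<rparr>"

text \<open>
  The value 0 off the carrier is needed because \<^locale>\<open>Metric_space\<close> demands nonnegativity
  and symmetry of the distance for all arguments.
\<close>

definition ip_dist :: "(real, 'h) module \<Rightarrow> ('h \<Rightarrow> 'h \<Rightarrow> real) \<Rightarrow> 'h \<Rightarrow> 'h \<Rightarrow> real" where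
  "ip_dist V ip x y =
     (if x \<in> carrier V \<and> y \<in> carrier V then sqrt (ip (x \<ominus>\<^bsub>V\<^esub> y) (x \<ominus>\<^bsub>V\<^esub> y)) else 0)"

locale real_inner_space = Module.module real_ring V
  for V :: "(real, 'h) module" (structure) +
  fixes ip :: "'h \<Rightarrow> 'h \<Rightarrow> real"
  assumes ip_commute: "\<lbrakk>x \<in> carrier V; y \<in> carrier V\<rbrakk> \<Longrightarrow> ip x y = ip y x"
    and ip_add_left: "\<lbrakk>x \<in> carrier V; y \<in> carrier V; z \<in> carrier V\<rbrakk> \<Longrightarrow>
      ip (x \<oplus> y) z = ip x z + ip y z"
    and ip_smult_left: "\<lbrakk>x \<in> carrier V; y \<in> carrier V\<rbrakk> \<Longrightarrow> ip (a \<odot>\<^bsub>V\<^esub> x) y = a * ip x y"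
    and ip_ge_zero: "x \<in> carrier V \<Longrightarrow> 0 \<le> ip x x"
    and ip_eq_zero_iff: "x \<in> carrier V \<Longrightarrow> ip x x = 0 \<longleftrightarrow> x = \<zero>"

locale hilbert_space = real_inner_space +
  assumes complete: "Metric_space.mcomplete (carrier V) (ip_dist V ip)"

definition large_scale_lipschitz ::
  "'a set \<Rightarrow> ('a \<Rightarrow> 'a \<Rightarrow> real) \<Rightarrow> 'b set \<Rightarrow> ('b \<Rightarrow> 'b \<Rightarrow> real) \<Rightarrow> ('a \<Rightarrow> 'b) \<Rightarrow> bool" where
  "large_scale_lipschitz M dM N dN f \<longleftrightarrow> f \<in> M \<rightarrow> N \<and>
     (\<exists>C>0. \<exists>D\<ge>0. \<forall>x\<in>M. \<forall>x'\<in>M. dN (f x) (f x') \<le> C * dM x x' + D)"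

text \<open>For unbounded \<open>M\<close> the infimum is over a nonempty set of nonnegative reals.\<close>

definition compression ::
  "'a set \<Rightarrow> ('a \<Rightarrow> 'a \<Rightarrow> real) \<Rightarrow> ('b \<Rightarrow> 'b \<Rightarrow> real) \<Rightarrow> ('a \<Rightarrow> 'b) \<Rightarrow> real \<Rightarrow> real" where
  "compression M dM dN f r = Inf {dN (f x) (f y) | x y. x \<in> M \<and> y \<in> M \<and> dM x y \<ge> r}"

definition asymptotic_compression ::
  "'a set \<Rightarrow> ('a \<Rightarrow> 'a \<Rightarrow> real) \<Rightarrow> ('b \<Rightarrow> 'b \<Rightarrow> real) \<Rightarrow> ('a \<Rightarrow> 'b) \<Rightarrow> ereal" where
  "asymptotic_compression M dM dN f =
     Liminf at_top (\<lambda>r. ereal (ln (max (compression M dM dN f r) 1) / ln r))"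

text \<open>
  HOL has no quantification over types, so ``all Hilbert spaces'' means all Hilbert spaces whose
  underlying set consists of elements of a universe type \<open>'h\<close>, which is a parameter
  (an arbitrary type in the results). Nothing is lost: the closed span of the image of a map
  \<open>f\<close> from \<open>M \<subseteq> UNIV :: 'a set\<close> has at most as many elements as the type
  \<open>'a \<Rightarrow> real\<close> when \<open>M\<close> is infinite, so any universe at least that large yields the
  absolute supremum.
\<close>

definition hilbert_compression :: "'h itself \<Rightarrow> 'a set \<Rightarrow> ('a \<Rightarrow> 'a \<Rightarrow> real) \<Rightarrow> ereal" where
  "hilbert_compression (U :: 'h itself) M dM =
     Sup {asymptotic_compression M dM (ip_dist V ip) f | (V :: (real, 'h) module) ip f.
            hilbert_space V ip \<and> large_scale_lipschitz M dM (carrier V) (ip_dist V ip) f}"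

definition uniform_embedding ::
  "'a set \<Rightarrow> ('a \<Rightarrow> 'a \<Rightarrow> real) \<Rightarrow> 'b set \<Rightarrow> ('b \<Rightarrow> 'b \<Rightarrow> real) \<Rightarrow> ('a \<Rightarrow> 'b) \<Rightarrow> bool" where
  "uniform_embedding M dM N dN f \<longleftrightarrow> f \<in> M \<rightarrow> N \<and>
     (\<exists>\<rho>\<^sub>1 \<rho>\<^sub>2 :: real \<Rightarrow> real.
        mono_on {0..} \<rho>\<^sub>1 \<and> mono_on {0..} \<rho>\<^sub>2 \<and>
        filterlim \<rho>\<^sub>1 at_top at_top \<and> filterlim \<rho>\<^sub>2 at_top at_top \<and>
        (\<forall>x\<in>M. \<forall>y\<in>M. \<rho>\<^sub>1 (dM x y) \<le> dN (f x) (f y) \<and> dN (f x) (f y) \<le> \<rho>\<^sub>2 (dM x y)))"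

definition uniformly_embeddable_in_hilbert ::
  "'h itself \<Rightarrow> 'a set \<Rightarrow> ('a \<Rightarrow> 'a \<Rightarrow> real) \<Rightarrow> bool" where
  "uniformly_embeddable_in_hilbert (U :: 'h itself) M dM \<longleftrightarrow>
     (\<exists>(V :: (real, 'h) module) ip f.
        hilbert_space V ip \<and> uniform_embedding M dM (carrier V) (ip_dist V ip) f)"

text \<open>
  Two consistency checks: the distance of an inner product space is a metric in the sense of
  \<^locale>\<open>Metric_space\<close>, so that completeness above has its usual meaning, and the Hilbert
  spaces given by type classes are instances.
\<close>

context real_inner_space
begin

lemma carrier_real [simp]: "a \<in> carrier real_ring"
  by (simp add: real_ring_def)

lemma ip_zero_left: "y \<in> carrier V \<Longrightarrow> ip \<zero> y = 0"
  using ip_add_left[of "\<zero>" "\<zero>" y] by simp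

lemma ip_minus_left: "\<lbrakk>x \<in> carrier V; y \<in> carrier V\<rbrakk> \<Longrightarrow> ip (\<ominus> x) y = - ip x y"
  using ip_add_left[of x "\<ominus> x" y] ip_zero_left[of y] by (simp add: M.r_neg)

lemma ip_add_self:
  assumes "x \<in> carrier V" "y \<in> carrier V"
  shows "ip (x \<oplus> y) (x \<oplus> y) = ip x x + 2 * ip x y + ip y y"
  using assms
  by (simp add: ip_add_left ip_commute[of x "x \<oplus> y"] ip_commute[of y "x \<oplus> y"] ip_commute[of y x])

lemma ip_smult_self: "x \<in> carrier V \<Longrightarrow> ip (a \<odot>\<^bsub>V\<^esub> x) (a \<odot>\<^bsub>V\<^esub> x) = a\<^sup>2 * ip x x"
  by (simp add: ip_smult_left ip_commute[of x "a \<odot>\<^bsub>V\<^esub> x"] power2_eq_square)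

lemma Cauchy_Schwarz_ip:
  assumes x: "x \<in> carrier V" and y: "y \<in> carrier V"
  shows "(ip x y)\<^sup>2 \<le> ip x x * ip y y"
proof (cases "y = \<zero>")
  case True
  then show ?thesis using x ip_commute[of x "\<zero>"] ip_zero_left by simp
next
  case False
  then have pos: "ip y y > 0" using ip_ge_zero[OF y] ip_eq_zero_iff[OF y] by linarith
  define t where "t = - (ip x y / ip y y)"
  have "0 \<le> ip (x \<oplus> t \<odot>\<^bsub>V\<^esub> y) (x \<oplus> t \<odot>\<^bsub>V\<^esub> y)"
    using x y by (intro ip_ge_zero M.a_closed smult_closed carrier_real)
  also have "\<dots> = ip x x + 2 * (t * ip x y) + t\<^sup>2 * ip y y"
    using x y
    by (simp add: ip_add_self ip_smult_self)
      (simp add: ip_smult_left ip_commute[of x "t \<odot>\<^bsub>V\<^esub> y"] ip_commute[of y x])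
  also have "\<dots> = ip x x - (ip x y)\<^sup>2 / ip y y"
    using pos by (simp add: t_def field_simps power2_eq_square)
  finally show ?thesis using pos by (simp add: field_simps)
qed

lemma norm_triangle_ip:
  assumes x: "x \<in> carrier V" and y: "y \<in> carrier V"
  shows "sqrt (ip (x \<oplus> y) (x \<oplus> y)) \<le> sqrt (ip x x) + sqrt (ip y y)"
proof (rule real_le_lsqrt)
  have "ip x y \<le> sqrt (ip x x * ip y y)"
    by (rule real_le_rsqrt[OF Cauchy_Schwarz_ip[OF x y]])
  then show "ip (x \<oplus> y) (x \<oplus> y) \<le> (sqrt (ip x x) + sqrt (ip y y))\<^sup>2"
    using x y by (simp add: ip_add_self power2_sum ip_ge_zero real_sqrt_mult)
qed (use x y in \<open>simp add: ip_ge_zero\<close>)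

lemma Metric_space_ip_dist: "Metric_space (carrier V) (ip_dist V ip)"
proof
  show "0 \<le> ip_dist V ip x y" for x y
    by (simp add: ip_dist_def ip_ge_zero)
  have neg: "ip (\<ominus> w) (\<ominus> w) = ip w w" if "w \<in> carrier V" for w
    using that by (simp add: ip_minus_left ip_commute[of w "\<ominus> w"])
  show "ip_dist V ip x y = ip_dist V ip y x" for x y
  proof (cases "x \<in> carrier V \<and> y \<in> carrier V")
    case True
    then have "y \<ominus> x = \<ominus> (x \<ominus> y)"
      by (simp add: a_minus_def M.minus_add M.a_comm)
    then show ?thesis using True neg[of "x \<ominus> y"] by (simp add: ip_dist_def)
  qed (auto simp: ip_dist_def)
  show "ip_dist V ip x y = 0 \<longleftrightarrow> x = y" if "x \<in> carrier V" "y \<in> carrier V" for x y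
    using that M.minus_equality[of x "\<ominus> y"]
    by (auto simp: ip_dist_def ip_eq_zero_iff a_minus_def M.r_neg)
  show "ip_dist V ip x z \<le> ip_dist V ip x y + ip_dist V ip y z"
    if "x \<in> carrier V" "y \<in> carrier V" "z \<in> carrier V" for x y z
  proof -
    have "x \<ominus> z = (x \<ominus> y) \<oplus> (y \<ominus> z)"
      using that M.r_neg1[of y "\<ominus> z"] by (simp add: a_minus_def M.a_assoc)
    then show ?thesis
      using that norm_triangle_ip[of "x \<ominus> y" "y \<ominus> z"] by (simp add: ip_dist_def)
  qed
qed

end

definition module_of_type :: "'h::real_vector itself \<Rightarrow> (real, 'h) module" where
  "module_of_type (U :: 'h itself) =
     \<lparr>carrier = UNIV, mult = (\<lambda>_ _. 0), one = 0, zero = 0, add = (+), smult = scaleR\<rparr>"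

lemma abelian_group_module_of_type: "abelian_group (module_of_type TYPE('h::real_vector))"
proof (rule abelian_groupI)
  show "\<exists>y\<in>carrier (module_of_type TYPE('h)).
      y \<oplus>\<^bsub>module_of_type TYPE('h)\<^esub> x = \<zero>\<^bsub>module_of_type TYPE('h)\<^esub>" for x
    by (intro bexI[of _ "- x"]) (simp_all add: module_of_type_def)
qed (simp_all add: module_of_type_def add_ac)

lemma module_module_of_type:
  "Module.module real_ring (module_of_type TYPE('h::real_vector))"
proof (rule moduleI)
  show "cring real_ring"
  proof (rule cringI)
    show "abelian_group real_ring"
    proof (rule abelian_groupI)
      show "\<exists>y\<in>carrier real_ring. y \<oplus>\<^bsub>real_ring\<^esub> x = \<zero>\<^bsub>real_ring\<^esub>" for x
        by (intro bexI[of _ "- x"]) (simp_all add: real_ring_def)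
    qed (simp_all add: real_ring_def)
    show "comm_monoid real_ring"
      by (rule comm_monoidI) (simp_all add: real_ring_def)
  qed (simp add: real_ring_def distrib_right)
qed (simp add: abelian_group_module_of_type,
    simp_all add: module_of_type_def real_ring_def scaleR_add_left scaleR_add_right)

lemma minus_module_of_type: "x \<ominus>\<^bsub>module_of_type TYPE('h::real_vector)\<^esub> y = x - y"
proof -
  let ?V = "module_of_type TYPE('h)"
  interpret abelian_group ?V by (rule abelian_group_module_of_type)
  have "\<ominus>\<^bsub>?V\<^esub> y = - y"
    by (rule minus_equality) (auto simp: module_of_type_def)
  then show ?thesis by (simp add: a_minus_def) (simp add: module_of_type_def)
qed

lemma ip_dist_of_type: "ip_dist (module_of_type TYPE('h::real_inner)) inner = dist"
  by (intro ext) (simp add: ip_dist_def minus_module_of_type dist_norm norm_eq_sqrt_inner,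
                  simp add: module_of_type_def)

lemma hilbert_space_of_type:
  "hilbert_space (module_of_type TYPE('h::{real_inner, complete_space})) inner"
proof -
  have "real_inner_space (module_of_type TYPE('h)) inner"
    by (intro real_inner_space.intro module_module_of_type real_inner_space_axioms.intro)
      (simp_all add: module_of_type_def inner_add_left, simp add: inner_commute)
  moreover have "Metric_space.mcomplete (UNIV :: 'h set) dist"
    by (simp add: complete_UNIV)
  ultimately show ?thesis
    by (intro hilbert_space.intro hilbert_space_axioms.intro)
      (simp_all add: ip_dist_of_type, simp add: module_of_type_def)
qed

end

theory Submission
  imports Defs
begin

text \<open>
  A positive Hilbert space compression provides a large-scale Lipschitz map \<open>f\<close> with
  \<open>R\<^sub>f > \<epsilon> > 0\<close>, so that \<open>\<rho>\<^sub>f(r) \<ge> r powr \<epsilon>\<close> for all large \<open>r\<close>. This power function is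
  the lower control function, and the large-scale Lipschitz estimate is the upper one.
  The compression is never negative, since the constant map into the zero space contributes 0.
\<close>

text \<open>The universe \<open>'h\<close> is an arbitrary type with no vector structure, so the
  zero space is built on a single point of it.\<close>

lemma hilbert_space_singleton:
  fixes z :: 'h
  obtains V :: "(real, 'h) module" where "carrier V = {z}" "hilbert_space V (\<lambda>_ _. 0)"
proof -
  define V :: "(real, 'h) module" where
    "V = \<lparr>carrier = {z}, mult = (\<lambda>_ _. z), one = z, zero = z, add = (\<lambda>_ _. z), smult = (\<lambda>_ _. z)\<rparr>"
  have "abelian_group V"
    by (rule abelian_groupI) (simp_all add: V_def)
  moreover have "cring real_ring"
    by (rule module.axioms(1)[OF module_module_of_type[where 'h = real]])
  ultimately have "Module.module real_ring V"
    by (intro moduleI) (simp_all add: V_def)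
  then interpret real_inner_space V "\<lambda>_ _. 0"
    by (intro real_inner_space.intro real_inner_space_axioms.intro) (simp_all add: V_def)
  interpret Metric_space "carrier V" "ip_dist V (\<lambda>_ _. 0)"
    by (rule Metric_space_ip_dist)
  \<comment> \<open>Completeness comes from compactness, which is immediate for a finite
    carrier.\<close>
  have "compact_space mtopology"
    unfolding compact_space_def topspace_mtopology
    by (rule finite_imp_compactin) (simp_all only: topspace_mtopology order_refl, simp add: V_def)
  then have "mcomplete"
    by (rule compact_space_imp_mcomplete)
  then have "hilbert_space V (\<lambda>_ _. 0)"
    by unfold_locales
  then show thesis
    by (intro that[of V]) (simp_all add: V_def)
qed

text \<open>The truncation at 1 makes the numerator nonnegative, and \<open>ln r\<close> is positive
  once r > 1.\<close>

lemma asymptotic_compression_nonneg: "0 \<le> asymptotic_compression M d dN f"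
  unfolding asymptotic_compression_def
proof (rule Liminf_bounded)
  show "\<forall>\<^sub>F r in at_top. 0 \<le> ereal (ln (max (compression M d dN f r) 1) / ln r)"
    using eventually_gt_at_top[of 1] by eventually_elim simp
qed

text \<open>The supremum of the empty set in \<open>ereal\<close> is minus infinity, so
  nonnegativity requires an actual map in the family.\<close>

lemma hilbert_compression_nonneg:
  assumes "\<And>x y. 0 \<le> d x y"
  shows "0 \<le> hilbert_compression TYPE('h) M d"
proof -
  obtain V :: "(real, 'h) module" where carrier: "carrier V = {undefined}"
    and V: "hilbert_space V (\<lambda>_ _. 0)"
    by (rule hilbert_space_singleton)
  let ?f = "\<lambda>_. undefined" and ?ip = "\<lambda>_ _. 0"
  have "large_scale_lipschitz M d (carrier V) (ip_dist V ?ip) ?f"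
    unfolding large_scale_lipschitz_def using carrier assms
    by (auto simp: ip_dist_def intro!: exI[of _ 1])
  then have "asymptotic_compression M d (ip_dist V ?ip) ?f \<le> hilbert_compression TYPE('h) M d"
    unfolding hilbert_compression_def using V by (intro Sup_upper) blast
  then show ?thesis
    using asymptotic_compression_nonneg order_trans by blast
qed

lemma compression_le:
  assumes "\<And>u v. 0 \<le> dN u v" "x \<in> M" "y \<in> M" "r \<le> d x y"
  shows "compression M d dN f r \<le> dN (f x) (f y)"
  unfolding compression_def using assms by (intro cInf_lower) (auto intro: bdd_belowI[of _ 0])

lemma asymptotic_compression_pos_imp_powr_le:
  assumes "0 < asymptotic_compression M d dN f"
  obtains \<epsilon> r\<^sub>0 where "\<epsilon> > 0" "r\<^sub>0 > 1" "\<And>r. r \<ge> r\<^sub>0 \<Longrightarrow> r powr \<epsilon> \<le> compression M d dN f r"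
proof -
  \<comment> \<open>The asymptotic compression may be infinite; a value strictly between 0 and it is
    a finite real.\<close>
  obtain e where "0 < e" and e: "e < asymptotic_compression M d dN f"
    using dense[OF assms] by blast
  then obtain \<epsilon> where \<epsilon>: "e = ereal \<epsilon>" "\<epsilon> > 0"
    by (cases e) auto
  have "\<forall>\<^sub>F r in at_top. ereal \<epsilon> < ereal (ln (max (compression M d dN f r) 1) / ln r)"
    using less_LiminfD e \<epsilon> unfolding asymptotic_compression_def by blast
  then obtain r\<^sub>1 where r1: "\<And>r. r \<ge> r\<^sub>1 \<Longrightarrow> \<epsilon> < ln (max (compression M d dN f r) 1) / ln r"
    by (auto simp: eventually_at_top_linorder)
  \<comment> \<open>The bound 2 makes \<open>ln r\<close> positive, so the quotient can be
    cleared.\<close>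
  have "r powr \<epsilon> \<le> compression M d dN f r" if "r \<ge> max r\<^sub>1 2" for r
  proof -
    have "\<epsilon> * ln r < ln (max (compression M d dN f r) 1)"
      using r1[of r] that by (simp add: pos_less_divide_eq)
    then have "exp (\<epsilon> * ln r) < max (compression M d dN f r) 1"
      by (metis exp_less_cancel_iff exp_ln less_max_iff_disj zero_less_one)
    \<comment> \<open>Since the power is at least 1 and lies strictly below the maximum, that
      maximum must be the compression itself.\<close>
    moreover have "exp (\<epsilon> * ln r) = r powr \<epsilon>" "1 \<le> r powr \<epsilon>"
      using that \<epsilon> by (simp_all add: powr_def)
    ultimately show ?thesis by simp
  qed
  with \<epsilon> show thesis by (intro that[of \<epsilon> "max r\<^sub>1 2"]) auto
qed

lemma uniform_embedding_if_asymptotic_compression_pos: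
  assumes lsl: "large_scale_lipschitz M d N dN f"
    and pos: "0 < asymptotic_compression M d dN f"
    and nonneg: "\<And>u v. 0 \<le> dN u v"
  shows "uniform_embedding M d N dN f"
proof -
  obtain \<epsilon> r\<^sub>0 where \<epsilon>: "\<epsilon> > 0" and r0: "r\<^sub>0 > 1"
    and lower: "\<And>r. r \<ge> r\<^sub>0 \<Longrightarrow> r powr \<epsilon> \<le> compression M d dN f r"
    using asymptotic_compression_pos_imp_powr_le[OF pos] by blast
  obtain C D where f: "f \<in> M \<rightarrow> N" and C: "C > 0"
    and upper: "\<And>x y. x \<in> M \<Longrightarrow> y \<in> M \<Longrightarrow> dN (f x) (f y) \<le> C * d x y + D"
    using lsl unfolding large_scale_lipschitz_def by blast
  \<comment> \<open>Below \<open>r\<^sub>0\<close> only the nonnegativity of \<open>dN\<close> is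
    available, hence the value 0; the jump at \<open>r\<^sub>0\<close> is upward, so monotonicity
    survives.\<close>
  define \<rho>\<^sub>1 where "\<rho>\<^sub>1 t = (if t \<ge> r\<^sub>0 then t powr \<epsilon> else 0)" for t
  define \<rho>\<^sub>2 where "\<rho>\<^sub>2 t = C * t + D" for t
  have "mono_on {0..} \<rho>\<^sub>1"
    using r0 \<epsilon> by (auto simp: mono_on_def \<rho>\<^sub>1_def intro: powr_mono2)
  moreover have "mono_on {0..} \<rho>\<^sub>2"
    using C by (auto simp: mono_on_def \<rho>\<^sub>2_def)
  moreover have "filterlim \<rho>\<^sub>1 at_top at_top"
  proof (rule filterlim_at_top_mono)
    show "filterlim (\<lambda>t. exp (\<epsilon> * ln t)) at_top at_top"
      using \<epsilon>
      by (intro filterlim_compose[OF exp_at_top]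
          filterlim_tendsto_pos_mult_at_top[OF tendsto_const] ln_at_top)
    show "\<forall>\<^sub>F t in at_top. exp (\<epsilon> * ln t) \<le> \<rho>\<^sub>1 t"
      using eventually_ge_at_top[of r\<^sub>0]
      by eventually_elim (use r0 in \<open>simp add: \<rho>\<^sub>1_def powr_def\<close>)
  qed
  moreover have "filterlim \<rho>\<^sub>2 at_top at_top"
    unfolding \<rho>\<^sub>2_def add.commute[of _ D] using C
    by (intro filterlim_tendsto_add_at_top[OF tendsto_const]
        filterlim_tendsto_pos_mult_at_top[OF tendsto_const] filterlim_ident)
  moreover have "\<rho>\<^sub>1 (d x y) \<le> dN (f x) (f y)" if "x \<in> M" "y \<in> M" for x y
    \<comment> \<open>The compression is evaluated at r = \<open>d x y\<close>, where the pair x, y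
      itself competes in the infimum.\<close>
    using order_trans[OF lower compression_le[OF nonneg that order_refl]] nonneg
    by (simp add: \<rho>\<^sub>1_def)
  moreover have "dN (f x) (f y) \<le> \<rho>\<^sub>2 (d x y)" if "x \<in> M" "y \<in> M" for x y
    unfolding \<rho>\<^sub>2_def using that by (rule upper)
  ultimately show ?thesis
    unfolding uniform_embedding_def using f by blast
qed

theorem proposition3p1:
  fixes M :: "'a set" and d :: "'a \<Rightarrow> 'a \<Rightarrow> real"
  assumes "Metric_space M d"
    and "\<not> Metric_space.mbounded M d M"
    and "hilbert_compression TYPE('h) M d \<noteq> 0"
  shows "uniformly_embeddable_in_hilbert TYPE('h) M d"
proof -
  have "0 < hilbert_compression TYPE('h) M d"
    using hilbert_compression_nonneg[of d M] Metric_space.nonneg[OF assms(1)] assms(3)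
    by (metis order_le_less)
  \<comment> \<open>A supremum strictly above 0 has a member strictly above 0, whether or not it is
    attained.\<close>
  then obtain V :: "(real, 'h) module" and ip f where V: "hilbert_space V ip"
    and f: "large_scale_lipschitz M d (carrier V) (ip_dist V ip) f"
      "0 < asymptotic_compression M d (ip_dist V ip) f"
    unfolding hilbert_compression_def less_Sup_iff by blast
  interpret hilbert_space V ip by (rule V)
  have "uniform_embedding M d (carrier V) (ip_dist V ip) f"
    using f Metric_space.nonneg[OF Metric_space_ip_dist]
    by (rule uniform_embedding_if_asymptotic_compression_pos)
  with V show ?thesis
    unfolding uniformly_embeddable_in_hilbert_def by blast
qed

end
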